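(* Let $d\ge2$ and $0<\alpha\le1$. (1) Let $q$ be an odd prime power, $Q$ a nondegenerate quadratic form on $\mathbb F_q^d$, and let $P\subseteq\mathbb F_q^d$ be nonempty. The number of pins $p\in\mathbb F_q^d$ satisfying $|\Delta_p^Q(P)|\le(1-\alpha)q$ is at most $$\frac{(1-\alpha)(q^{d+1}-q^d)}{\alpha^2|P|}.$$ (2) Let $q$ be any prime power, let $Y\subseteq\mathbb F_q^d$ be nonempty, and fix a nondegenerate bilinear pairing $\langle\cdot,\cdot\rangle$ on $\mathbb F_q^d$. Every set of pairwise nonproportional nonzero pins $p\in\mathbb F_q^d$ satisfying $|\Pi_p(Y)|\le(1-\alpha)q$ has cardinality at most $$\frac{(1-\alpha)(q^d-|Y|)}{\alpha^2|Y|}.$$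
   Context: For $p\in\mathbb F_q^d$ and nonempty $P,Y\subseteq\mathbb F_q^d$, $$\Delta_p^Q(P)=\{Q(x-p):x\in P\},\qquad\Pi_p(Y)=\{\langle p,x\rangle:x\in Y\}.$$ *)

theory Defs
  imports "HOL-Analysis.Cartesian_Space"
begin

text \<open>
  The field with \<open>q\<close> elements is a type \<open>'a\<close> of class \<open>{field, finite}\<close> with \<open>q = CARD('a)\<close>; its
  \<open>d\<close>-dimensional coordinate space is \<open>'a ^ 'n\<close> with \<open>d = CARD('n)\<close>.  The constant \<open>bilinear\<close> of
  HOL-Analysis is restricted to real vector spaces, hence the following definition.
\<close>

definition bilinear_form :: "('a::field ^ 'n \<Rightarrow> 'a ^ 'n \<Rightarrow> 'a) \<Rightarrow> bool" where
  "bilinear_form B \<longleftrightarrow>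
     (\<forall>x. Vector_Spaces.linear (*s) (*) (\<lambda>y. B x y)) \<and>
     (\<forall>y. Vector_Spaces.linear (*s) (*) (\<lambda>x. B x y))"

text \<open>No symmetry is assumed, so both radicals are required to vanish.\<close>

definition nondegenerate_pairing :: "('a::field ^ 'n \<Rightarrow> 'a ^ 'n \<Rightarrow> 'a) \<Rightarrow> bool" where
  "nondegenerate_pairing B \<longleftrightarrow>
     bilinear_form B \<and>
     (\<forall>x. (\<forall>y. B x y = 0) \<longrightarrow> x = 0) \<and>
     (\<forall>y. (\<forall>x. B x y = 0) \<longrightarrow> y = 0)"

definition polar_form :: "('a::field ^ 'n \<Rightarrow> 'a) \<Rightarrow> 'a ^ 'n \<Rightarrow> 'a ^ 'n \<Rightarrow> 'a" where
  "polar_form Q x y = Q (x + y) - Q x - Q y"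

definition quadratic_form :: "('a::field ^ 'n \<Rightarrow> 'a) \<Rightarrow> bool" where
  "quadratic_form Q \<longleftrightarrow>
     (\<forall>c x. Q (c *s x) = c\<^sup>2 * Q x) \<and> bilinear_form (polar_form Q)"

text \<open>
  Nondegeneracy is that of the polar form, which is twice the symmetric bilinear form with diagonal
  \<open>Q\<close>; this is the usual notion in odd characteristic, the only case in which it is used.
\<close>

definition nondegenerate_quadratic_form :: "('a::field ^ 'n \<Rightarrow> 'a) \<Rightarrow> bool" where
  "nondegenerate_quadratic_form Q \<longleftrightarrow>
     quadratic_form Q \<and> nondegenerate_pairing (polar_form Q)"

definition pinned_distances ::
  "('a::field ^ 'n \<Rightarrow> 'a) \<Rightarrow> 'a ^ 'n \<Rightarrow> ('a ^ 'n) set \<Rightarrow> 'a set" where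
  "pinned_distances Q p P = (\<lambda>x. Q (x - p)) ` P"

definition pinned_products ::
  "('a::field ^ 'n \<Rightarrow> 'a ^ 'n \<Rightarrow> 'a) \<Rightarrow> 'a ^ 'n \<Rightarrow> ('a ^ 'n) set \<Rightarrow> 'a set" where
  "pinned_products B p Y = (\<lambda>x. B p x) ` Y"

definition proportional :: "'a::field ^ 'n \<Rightarrow> 'a ^ 'n \<Rightarrow> bool" where
  "proportional p p' \<longleftrightarrow> (\<exists>c. c \<noteq> 0 \<and> p' = c *s p)"

end

theory Submission
  imports Defs "HOL-Analysis.Convex"
begin

text \<open>
  A function on a finite set \<open>X\<close> with few values has many collisions, by Cauchy--Schwarz.  The
  collisions, summed over all pins, can be counted exactly: for \<open>x \<noteq> x'\<close> the pins with
  \<open>Q (x - p) = Q (x' - p)\<close>, or with \<open>\<langle>p, x\<rangle> = \<langle>p, x'\<rangle>\<close>, form an affine hyperplane.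
  For products, the collision count is constant on each punctured line \<open>{c p | c \<noteq> 0}\<close>, so that
  pairwise nonproportional pins account for only a \<open>1 / (q - 1)\<close> part of the sum over \<open>p \<noteq> 0\<close>.
  Both arguments give the bound with \<open>\<alpha>\<close> in place of \<open>\<alpha>\<^sup>2\<close>.
\<close>

section \<open>Collisions and Cauchy-Schwarz\<close>

text \<open>The pairs are ordered and include the diagonal, which makes this exactly the second
  moment of the fiber sizes of \<open>f\<close>.\<close>

definition collisions :: "('x \<Rightarrow> 'v) \<Rightarrow> 'x set \<Rightarrow> real" where
  "collisions f X = (\<Sum>x\<in>X. \<Sum>y\<in>X. of_bool (f x = f y))"

lemma collisions_eq_sum_fibers:
  assumes "finite X"
  shows "collisions f X = (\<Sum>t\<in>f ` X. (real (card {x\<in>X. f x = t}))\<^sup>2)"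
proof -
  have inner: "(\<Sum>y\<in>X. of_bool (f x = f y)) = real (card {y\<in>X. f y = f x})" for x
    using assms by (simp add: eq_commute Int_def flip: sum.inter_filter)
  have "collisions f X = (\<Sum>t\<in>f ` X. \<Sum>x\<in>{x\<in>X. f x = t}. real (card {y\<in>X. f y = f x}))"
    unfolding collisions_def inner using assms by (rule sum.image_gen)
  also have "\<dots> = (\<Sum>t\<in>f ` X. (real (card {x\<in>X. f x = t}))\<^sup>2)"
    by (intro sum.cong) (simp_all add: power2_eq_square)
  finally show ?thesis .
qed

lemma card_power2_le_card_image_mult_collisions:
  assumes "finite X"
  shows "(real (card X))\<^sup>2 \<le> real (card (f ` X)) * collisions f X"
proof -
  have "real (card X) = (\<Sum>t\<in>f ` X. real (card {x\<in>X. f x = t}))"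
    using sum.image_gen[OF assms, of "\<lambda>_. 1::real" f] by simp
  then show ?thesis
    using sum_squared_le_sum_of_squares[of "\<lambda>t. real (card {x\<in>X. f x = t})" "f ` X"]
    by (simp add: collisions_eq_sum_fibers[OF assms] mult.commute)
qed

lemma collisions_nonneg: "0 \<le> collisions f X"
  by (simp add: collisions_def sum_nonneg)

text \<open>This makes the excess \<open>q * collisions f X - (card X)\<^sup>2\<close>, with
  \<open>q\<close> the size of the codomain, nonnegative. Sums of excesses over bad pins can
  therefore be enlarged to sums over more pins.\<close>

lemma card_power2_le_CARD_mult_collisions:
  fixes f :: "'x \<Rightarrow> 'v::finite"
  assumes "finite X"
  shows "(real (card X))\<^sup>2 \<le> real CARD('v) * collisions f X"
proof -
  have "real (card (f ` X)) \<le> real CARD('v)"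
    by (simp add: card_mono)
  then show ?thesis
    using card_power2_le_card_image_mult_collisions[OF assms, of f]
      mult_right_mono[OF _ collisions_nonneg] by (meson order_trans)
qed

text \<open>Subtract \<open>(1 - \<alpha>) * (card X)\<^sup>2\<close> from both sides of
  Cauchy-Schwarz. Keeping the factor \<open>1 - \<alpha>\<close> on the right avoids a division and
  so covers \<alpha> = 1.\<close>

lemma excess_collisions_of_small_image:
  fixes f :: "'x \<Rightarrow> 'v::finite" and \<alpha> :: real
  assumes "finite X" and "real (card (f ` X)) \<le> (1 - \<alpha>) * real CARD('v)"
  shows "\<alpha> * (real (card X))\<^sup>2 \<le> (1 - \<alpha>) * (real CARD('v) * collisions f X - (real (card X))\<^sup>2)"
proof -
  have "(real (card X))\<^sup>2 \<le> (1 - \<alpha>) * real CARD('v) * collisions f X"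
    using card_power2_le_card_image_mult_collisions[OF assms(1), of f]
      mult_right_mono[OF assms(2) collisions_nonneg] by (meson order_trans)
  then show ?thesis
    by (simp add: algebra_simps)
qed

text \<open>Each bad pin forces a fixed amount of excess, so a bound on the total excess limits
  their number. Distances and products differ only in the value of \<open>M\<close>, the permitted
  total excess per point of \<open>X\<close>.\<close>

lemma card_bad_pins_le:
  fixes f :: "'p \<Rightarrow> 'x \<Rightarrow> 'v::finite" and \<alpha> M :: real
  assumes "finite X" "X \<noteq> {}" "0 < \<alpha>" "\<alpha> \<le> 1"
    and small: "\<And>p. p \<in> A \<Longrightarrow> real (card (f p ` X)) \<le> (1 - \<alpha>) * real CARD('v)"
    and excess: "(\<Sum>p\<in>A. real CARD('v) * collisions (f p) X - (real (card X))\<^sup>2) \<le> real (card X) * M"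
    and "0 \<le> M"
  shows "real (card A) \<le> (1 - \<alpha>) * M / (\<alpha>\<^sup>2 * real (card X))"
proof -
  have pos: "0 < real (card X)"
    using assms by (simp add: card_gt_0_iff)
  have "real (card A) * (\<alpha> * (real (card X))\<^sup>2)
      \<le> (\<Sum>p\<in>A. (1 - \<alpha>) * (real CARD('v) * collisions (f p) X - (real (card X))\<^sup>2))"
    using sum_mono[of A "\<lambda>_. \<alpha> * (real (card X))\<^sup>2"]
      excess_collisions_of_small_image[OF \<open>finite X\<close> small] by simp
  also have "\<dots> \<le> (1 - \<alpha>) * (real (card X) * M)"
    using mult_left_mono[OF excess] \<open>\<alpha> \<le> 1\<close> by (simp add: sum_distrib_left)
  finally have "real (card A) * (\<alpha> * real (card X)) * real (card X) \<le> (1 - \<alpha>) * M * real (card X)"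
    by (simp add: power2_eq_square algebra_simps)
  then have "real (card A) * (\<alpha> * real (card X)) \<le> (1 - \<alpha>) * M"
    using pos by simp
  \<comment> \<open>The bound with \<alpha> is weakened to the stated one, using
    \<open>\<alpha>\<^sup>2 \<le> \<alpha>\<close>.\<close>
  moreover have "real (card A) * (\<alpha>\<^sup>2 * real (card X)) \<le> real (card A) * (\<alpha> * real (card X))"
    using assms(3,4) by (intro mult_left_mono mult_right_mono) (simp_all add: power2_eq_square)
  ultimately show ?thesis
    using pos \<open>0 < \<alpha>\<close> by (simp add: pos_le_divide_eq)
qed

section \<open>Collisions summed over all pins\<close>

text \<open>Exchange the sums: a diagonal pair collides at every pin, any other pair at
  \<open>h\<close> pins.\<close>

lemma sum_collisions:
  fixes f :: "'p::finite \<Rightarrow> 'x \<Rightarrow> 'v"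
  assumes "finite X"
    and pair: "\<And>x y. \<lbrakk>x \<in> X; y \<in> X; x \<noteq> y\<rbrakk> \<Longrightarrow> real (card {p. f p x = f p y}) = h"
  shows "(\<Sum>p\<in>UNIV. collisions (f p) X)
    = real (card X) * real CARD('p) + ((real (card X))\<^sup>2 - real (card X)) * h"
proof -
  have row: "(\<Sum>y\<in>X. real (card {p. f p x = f p y})) = real CARD('p) + (real (card X) - 1) * h"
    if "x \<in> X" for x
  proof -
    have "(\<Sum>y\<in>X - {x}. real (card {p. f p x = f p y})) = (\<Sum>y\<in>X - {x}. h)"
      using that by (intro sum.cong refl pair) auto
    moreover have "real (card (X - {x})) = real (card X) - 1"
      using that assms(1) by (metis card_Suc_Diff1 add_diff_cancel_left' of_nat_Suc)
    ultimately show ?thesis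
      unfolding sum_constant using sum.remove[OF assms(1) that, of "\<lambda>y. real (card {p. f p x = f p y})"]
      by simp
  qed
  have "(\<Sum>p\<in>UNIV. collisions (f p) X) = (\<Sum>x\<in>X. \<Sum>y\<in>X. \<Sum>p\<in>UNIV. of_bool (f p x = f p y))"
    unfolding collisions_def by (subst sum.swap, rule sum.cong[OF refl], rule sum.swap)
  also have "\<dots> = (\<Sum>x\<in>X. \<Sum>y\<in>X. real (card {p. f p x = f p y}))"
    by simp
  also have "\<dots> = (\<Sum>x\<in>X. real CARD('p) + (real (card X) - 1) * h)"
    using row by simp
  finally show ?thesis
    by (simp add: algebra_simps power2_eq_square)
qed

text \<open>Translations permute the fibers of a nonzero functional, so all \<open>q\<close> of them
  have the same size. The product form avoids the exponent \<open>CARD('n) - 1\<close>.\<close>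

lemma card_hyperplane:
  fixes L :: "'a::{field,finite} ^ 'n::finite \<Rightarrow> 'a"
  assumes L: "Vector_Spaces.linear (*s) (*) L" and "L v \<noteq> 0"
  shows "CARD('a) * card {x. L x = c} = CARD('a) ^ CARD('n)"
proof -
  interpret L: Vector_Spaces.linear "(*s)" "(*)" L
    by (fact L)
  \<comment> \<open>Normalized so that \<open>L u = 1\<close>: adding \<open>(c - t) *s u\<close>
    then moves the fiber over \<open>t\<close> onto the fiber over \<open>c\<close>.\<close>
  define u where "u = inverse (L v) *s v"
  have u: "L u = 1"
    using assms(2) by (simp add: u_def L.scale)
  have fiber: "card {x. L x = t} = card {x. L x = c}" for t
  proof (rule bij_betw_same_card)
    show "bij_betw (\<lambda>x. x + (c - t) *s u) {x. L x = t} {x. L x = c}"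
      by (rule bij_betw_byWitness[where f' = "\<lambda>x. x - (c - t) *s u"])
        (auto simp: L.add L.diff L.scale u)
  qed
  have "(\<Union>t. {x. L x = t}) = UNIV"
    by auto
  then have "CARD('a ^ 'n) = (\<Sum>t\<in>UNIV. card {x. L x = t})"
    using card_UN_disjoint[of UNIV "\<lambda>t. {x. L x = t}"] by (simp add: disjoint_iff)
  also have "\<dots> = (\<Sum>t\<in>(UNIV :: 'a set). card {x. L x = c})"
    by (intro sum.cong refl fiber)
  finally show ?thesis
    by simp
qed

text \<open>Distinct points collide at a proportion \<open>1/q\<close> of the pins, so the terms
  quadratic in \<open>card X\<close> cancel. What remains comes from the diagonal.\<close>

lemma sum_excess_collisions:
  fixes f :: "'a ^ 'n::finite \<Rightarrow> 'x \<Rightarrow> 'a::{field,finite}"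
  assumes "finite X"
    and pair: "\<And>x y. \<lbrakk>x \<in> X; y \<in> X; x \<noteq> y\<rbrakk> \<Longrightarrow>
      CARD('a) * card {p. f p x = f p y} = CARD('a) ^ CARD('n)"
  shows "(\<Sum>p\<in>UNIV. real CARD('a) * collisions (f p) X - (real (card X))\<^sup>2)
    = real (card X) * (real CARD('a) ^ (CARD('n) + 1) - real CARD('a) ^ CARD('n))"
proof -
  have "real (card {p. f p x = f p y}) = real CARD('a) ^ CARD('n) / real CARD('a)"
    if "x \<in> X" "y \<in> X" "x \<noteq> y" for x y
    using pair[OF that, THEN arg_cong[of _ _ real]] by (simp add: field_simps)
  from sum_collisions[OF assms(1) this] show ?thesis
    by (simp add: sum_subtractf flip: sum_distrib_left) (simp add: field_simps)
qed

section \<open>Pins at which two given points collide\<close>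

lemma quadratic_form_diff:
  assumes "quadratic_form Q"
  shows "Q (x - p) = Q x + Q p - polar_form Q x p"
proof -
  interpret Vector_Spaces.linear "(*s)" "(*)" "polar_form Q x"
    using assms by (simp add: quadratic_form_def bilinear_form_def)
  have "Q ((-1) *s p) = (-1)\<^sup>2 * Q p"
    using assms unfolding quadratic_form_def by blast
  moreover have "(-1) *s p = - p"
    by (simp add: vec_eq_iff)
  ultimately have "Q (- p) = Q p"
    by simp
  moreover have "polar_form Q x (- p) = - polar_form Q x p"
    by (rule neg)
  ultimately show ?thesis
    by (simp add: polar_form_def[of Q x "- p"] algebra_simps)
qed

text \<open>The term \<open>Q p\<close> occurs on both sides and cancels, which leaves an affine
  equation in \<open>p\<close>. Its linear part is nonzero by nondegeneracy, since
  \<open>x - y\<close> is nonzero.\<close>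

lemma card_equidistant_pins:
  fixes Q :: "'a::{field,finite} ^ 'n::finite \<Rightarrow> 'a"
  assumes "nondegenerate_quadratic_form Q" and "x \<noteq> y"
  shows "CARD('a) * card {p. Q (x - p) = Q (y - p)} = CARD('a) ^ CARD('n)"
proof -
  have Q: "quadratic_form Q" and nondeg: "\<And>z. (\<forall>p. polar_form Q z p = 0) \<Longrightarrow> z = 0"
    and linl: "\<And>p. Vector_Spaces.linear (*s) (*) (\<lambda>z. polar_form Q z p)"
    and linr: "Vector_Spaces.linear (*s) (*) (polar_form Q (x - y))"
    using assms(1)
    by (auto simp: nondegenerate_quadratic_form_def nondegenerate_pairing_def bilinear_form_def)
  have diff: "polar_form Q (x - y) p = polar_form Q x p - polar_form Q y p" for p
    using module_hom.diff[OF Vector_Spaces.linear.axioms(3)[OF linl]] by simp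
  have "{p. Q (x - p) = Q (y - p)} = {p. polar_form Q (x - y) p = Q x - Q y}"
    unfolding diff quadratic_form_diff[OF Q] by (auto simp: algebra_simps)
  moreover obtain v where "polar_form Q (x - y) v \<noteq> 0"
    using nondeg[of "x - y"] assms(2) by auto
  ultimately show ?thesis
    using card_hyperplane[OF linr] by simp
qed

text \<open>These pins form the kernel of \<open>p \<mapsto> B p (x - y)\<close>, a nonzero
  functional because the radical in the second argument vanishes.\<close>

lemma card_equal_product_pins:
  fixes B :: "'a::{field,finite} ^ 'n::finite \<Rightarrow> 'a ^ 'n \<Rightarrow> 'a"
  assumes "nondegenerate_pairing B" and "x \<noteq> y"
  shows "CARD('a) * card {p. B p x = B p y} = CARD('a) ^ CARD('n)"
proof -
  have nondeg: "\<And>z. (\<forall>p. B p z = 0) \<Longrightarrow> z = 0"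
    and linl: "Vector_Spaces.linear (*s) (*) (\<lambda>p. B p (x - y))"
    and linr: "\<And>p. Vector_Spaces.linear (*s) (*) (B p)"
    using assms(1) by (auto simp: nondegenerate_pairing_def bilinear_form_def)
  have "B p (x - y) = B p x - B p y" for p
    using module_hom.diff[OF Vector_Spaces.linear.axioms(3)[OF linr]] .
  then have "{p. B p x = B p y} = {p. B p (x - y) = 0}"
    by simp
  moreover obtain v where "B v (x - y) \<noteq> 0"
    using nondeg[of "x - y"] assms(2) by auto
  ultimately show ?thesis
    using card_hyperplane[OF linl] by simp
qed

section \<open>Nonproportional pins and the two bounds\<close>

text \<open>The nonzero multiples of the members of \<open>S\<close> are pairwise distinct and
  nonzero, and \<open>g\<close> takes each value \<open>g p\<close> on all \<open>q - 1\<close>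
  multiples of \<open>p\<close>.\<close>

lemma sum_nonproportional_le:
  fixes g :: "'a::{field,finite} ^ 'n::finite \<Rightarrow> real" and S :: "('a ^ 'n) set"
  assumes "0 \<notin> S" and nonprop: "pairwise (\<lambda>p p'. \<not> proportional p p') S"
    and "\<And>p. 0 \<le> g p" and scale: "\<And>c p. c \<noteq> 0 \<Longrightarrow> g (c *s p) = g p"
  shows "(real CARD('a) - 1) * sum g S \<le> sum g (UNIV - {0})"
proof -
  let ?m = "\<lambda>(c, p). c *s p"
  have inj: "inj_on ?m ((UNIV - {0}) \<times> S)"
  proof -
    have "c = c' \<and> p = p'"
      if *: "c \<noteq> 0" "c' \<noteq> 0" "p \<in> S" "p' \<in> S" "c *s p = c' *s p'" for c c' p p'
    proof -
      have "p' = (inverse c' * c) *s p"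
        by (simp add: *(2,5) flip: vector_smult_assoc)
      then have "proportional p p'"
        using * unfolding proportional_def by (intro exI[of _ "inverse c' * c"]) simp
      then have "p = p'"
        using nonprop * unfolding pairwise_def by blast
      moreover have "p \<noteq> 0"
        using * assms(1) by auto
      ultimately show ?thesis 
        using * by (simp add: vector_mul_rcancel)
    qed
    then show ?thesis
      by (auto simp: inj_on_def)
  qed
  have "(real CARD('a) - 1) * sum g S = (\<Sum>c\<in>UNIV - {0::'a}. sum g S)"
    by (simp add: card_Diff_singleton of_nat_diff Suc_leI)
  also have "\<dots> = (\<Sum>(c, p)\<in>(UNIV - {0}) \<times> S. g (c *s p))"
    by (simp add: scale flip: sum.cartesian_product)
  also have "\<dots> = sum g (?m ` ((UNIV - {0}) \<times> S))"
    by (subst sum.reindex[OF inj]) (simp add: case_prod_unfold)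
  also have "\<dots> \<le> sum g (UNIV - {0})"
    using assms by (intro sum_mono2) (auto simp: vector_mul_eq_0)
  finally show ?thesis .
qed

lemma card_pins_small_distance_set_le:
  fixes Q :: "'a::{field,finite} ^ 'n::finite \<Rightarrow> 'a" and \<alpha> :: real
  assumes "0 < \<alpha>" "\<alpha> \<le> 1" and Q: "nondegenerate_quadratic_form Q" and "P \<noteq> {}"
  shows "real (card {p. real (card (pinned_distances Q p P)) \<le> (1 - \<alpha>) * real CARD('a)})
    \<le> (1 - \<alpha>) * (real CARD('a) ^ (CARD('n) + 1) - real CARD('a) ^ CARD('n))
        / (\<alpha>\<^sup>2 * real (card P))"
proof (rule card_bad_pins_le[where f = "\<lambda>p x. Q (x - p)"])
  let ?A = "{p. real (card (pinned_distances Q p P)) \<le> (1 - \<alpha>) * real CARD('a)}"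
  let ?g = "\<lambda>p. real CARD('a) * collisions (\<lambda>x. Q (x - p)) P - (real (card P))\<^sup>2"
  show "real (card ((\<lambda>x. Q (x - p)) ` P)) \<le> (1 - \<alpha>) * real CARD('a)" if "p \<in> ?A" for p
    using that by (simp add: pinned_distances_def)
  have "sum ?g ?A \<le> sum ?g UNIV"
    by (intro sum_mono2) (simp_all add: card_power2_le_CARD_mult_collisions)
  also have "\<dots> = real (card P) * (real CARD('a) ^ (CARD('n) + 1) - real CARD('a) ^ CARD('n))"
    using card_equidistant_pins[OF Q] by (intro sum_excess_collisions) simp_all
  finally show "sum ?g ?A
      \<le> real (card P) * (real CARD('a) ^ (CARD('n) + 1) - real CARD('a) ^ CARD('n))" .
  show "0 \<le> real CARD('a) ^ (CARD('n) + 1) - real CARD('a) ^ CARD('n)"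
    by (simp add: Suc_leI)
qed (use assms in simp_all)

lemma card_pins_small_product_set_le:
  fixes B :: "'a::{field,finite} ^ 'n::finite \<Rightarrow> 'a ^ 'n \<Rightarrow> 'a" and \<alpha> :: real
  assumes "0 < \<alpha>" "\<alpha> \<le> 1" and B: "nondegenerate_pairing B" and "Y \<noteq> {}" and "0 \<notin> S"
    and "pairwise (\<lambda>p p'. \<not> proportional p p') S"
    and small: "\<And>p. p \<in> S \<Longrightarrow> real (card (pinned_products B p Y)) \<le> (1 - \<alpha>) * real CARD('a)"
  shows "real (card S)
    \<le> (1 - \<alpha>) * (real CARD('a) ^ CARD('n) - real (card Y)) / (\<alpha>\<^sup>2 * real (card Y))"
proof (rule card_bad_pins_le[where f = B])
  let ?q = "real CARD('a)" and ?y = "real (card Y)"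
  let ?g = "\<lambda>p. ?q * collisions (B p) Y - ?y\<^sup>2"
  have lin: "Vector_Spaces.linear (*s) (*) (\<lambda>p. B p x)" for x
    using B by (simp add: nondegenerate_pairing_def bilinear_form_def)
  note hom = Vector_Spaces.linear.axioms(3)[OF lin]
  have scale: "B (c *s p) x = c * B p x" for c p x
    using module_hom.scale[OF hom] .
  \<comment> \<open>Passing from \<open>p\<close> to \<open>c *s p\<close> multiplies every product
    by the unit \<open>c\<close>, which preserves equality of products.\<close>
  then have coll_scale: "collisions (B (c *s p)) Y = collisions (B p) Y" if "c \<noteq> 0" for c p
    using that by (simp add: collisions_def)
  have zero: "B 0 x = 0" for x
    using module_hom.zero[OF hom] .
  have "(?q - 1) * sum ?g S \<le> sum ?g (UNIV - {0})"
    using assms(5,6) by (intro sum_nonproportional_le)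
      (simp_all add: card_power2_le_CARD_mult_collisions coll_scale)
  also have "\<dots> = sum ?g UNIV - ?g 0"
    by (simp add: sum_diff1)
  also have "sum ?g UNIV = ?y * (?q ^ (CARD('n) + 1) - ?q ^ CARD('n))"
    using card_equal_product_pins[OF B] by (intro sum_excess_collisions) simp_all
  \<comment> \<open>At the pin 0 all products vanish and every pair collides. Removing this term
    produces the \<open>- card Y\<close> in the bound, and the common factor \<open>q - 1\<close>
    then cancels.\<close>
  also have "?g 0 = (?q - 1) * ?y\<^sup>2"
    by (simp add: collisions_def zero algebra_simps power2_eq_square)
  also have "?y * (?q ^ (CARD('n) + 1) - ?q ^ CARD('n)) - (?q - 1) * ?y\<^sup>2
      = (?q - 1) * (?y * (?q ^ CARD('n) - ?y))"
    by (simp add: algebra_simps power2_eq_square)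
  finally have "(?q - 1) * sum ?g S \<le> (?q - 1) * (?y * (?q ^ CARD('n) - ?y))" .
  moreover have "0 < ?q - 1"
    using card_mono[of UNIV "{0::'a, 1}"] by simp
  ultimately show "sum ?g S \<le> ?y * (?q ^ CARD('n) - ?y)"
    by simp
  have "card Y \<le> CARD('a) ^ CARD('n)"
    using card_mono[of UNIV Y] by simp
  then show "0 \<le> ?q ^ CARD('n) - ?y"
    by (simp flip: of_nat_power)
qed (use assms in \<open>simp_all add: pinned_products_def\<close>)

theorem proposition5p3:
  fixes \<alpha> :: real
  assumes "2 \<le> CARD('n::finite)" and "0 < \<alpha>" and "\<alpha> \<le> 1"
  shows
    "(\<forall>(Q :: 'a::{field,finite} ^ 'n \<Rightarrow> 'a) (P :: ('a ^ 'n) set).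
        odd CARD('a) \<longrightarrow> nondegenerate_quadratic_form Q \<longrightarrow> P \<noteq> {} \<longrightarrow>
        real (card {p. real (card (pinned_distances Q p P)) \<le> (1 - \<alpha>) * real CARD('a)})
          \<le> (1 - \<alpha>) * (real CARD('a) ^ (CARD('n) + 1) - real CARD('a) ^ CARD('n))
              / (\<alpha>\<^sup>2 * real (card P)))
     \<and>
     (\<forall>(B :: 'b::{field,finite} ^ 'n \<Rightarrow> 'b ^ 'n \<Rightarrow> 'b) (Y :: ('b ^ 'n) set) (S :: ('b ^ 'n) set).
        nondegenerate_pairing B \<longrightarrow> Y \<noteq> {} \<longrightarrow> 0 \<notin> S \<longrightarrow>
        pairwise (\<lambda>p p'. \<not> proportional p p') S \<longrightarrow>
        (\<forall>p\<in>S. real (card (pinned_products B p Y)) \<le> (1 - \<alpha>) * real CARD('b)) \<longrightarrow>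
        real (card S)
          \<le> (1 - \<alpha>) * (real CARD('b) ^ CARD('n) - real (card Y)) / (\<alpha>\<^sup>2 * real (card Y)))"
proof (intro conjI allI impI, goal_cases)
  case (1 Q P)
  show ?case
    by (rule card_pins_small_distance_set_le[OF assms(2,3) 1(2,3)])
next
  case (2 B Y S)
  show ?case
    by (rule card_pins_small_product_set_le[OF assms(2,3) 2(1-4) bspec[OF 2(5)]])
qed

end
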